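(* Let $\ell>1$ be an integer and let $D=\{\mathbf{x}_1,\ldots,\mathbf{x}_n\}\subset\mathbb{R}^{\ell}$ be any set of $n$ linearly independent vectors. Let $\delta_1,\ldots,\delta_n>0$ be arbitrary positive real numbers. Then there exists a norm $\|\cdot\|_q$ on $\mathbb{R}^{\ell}$, induced by a positive definite quadratic form $q:\mathbb{R}^{\ell}\to\mathbb{R}$, such that $\|\mathbf{x}_k\|_q=\delta_k$ for all $k=1,2,\ldots,n$.
   Context: For a positive definite quadratic form $q:\mathbb{R}^{\ell}\to\mathbb{R}$, the norm induced by $q$ is $\|\mathbf{x}\|_q:=\sqrt{q(\mathbf{x})}$. *)

theory Defs
  imports "HOL-Analysis.Analysis"
begin

(* Real quadratic forms as homogeneous polynomials of degree 2 in the coordinates.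
   The coefficient matrix need not be symmetric; symmetrising it does not change q. *)
definition quadratic_form :: "(real ^ 'l \<Rightarrow> real) \<Rightarrow> bool" where
  "quadratic_form q \<longleftrightarrow>
     (\<exists>A :: real ^ 'l ^ 'l. \<forall>x. q x = (\<Sum>i\<in>UNIV. \<Sum>j\<in>UNIV. A $ i $ j * x $ i * x $ j))"

definition positive_definite :: "(real ^ 'l \<Rightarrow> real) \<Rightarrow> bool" where
  "positive_definite q \<longleftrightarrow> (\<forall>x. x \<noteq> 0 \<longrightarrow> q x > 0)"

definition induced_norm :: "(real ^ 'l \<Rightarrow> real) \<Rightarrow> real ^ 'l \<Rightarrow> real" where
  "induced_norm q x = sqrt (q x)"

(* Nonnegativity follows from the remaining axioms. *)
definition is_norm :: "('a :: real_vector \<Rightarrow> real) \<Rightarrow> bool" where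
  "is_norm N \<longleftrightarrow>
     (\<forall>x. N x = 0 \<longleftrightarrow> x = 0) \<and>
     (\<forall>a x. N (a *\<^sub>R x) = \<bar>a\<bar> * N x) \<and>
     (\<forall>x y. N (x + y) \<le> N x + N y)"

end

theory Submission
  imports Defs
begin

text \<open>
  Extend the given vectors to a basis. Rescaling each basis vector by a positive factor
  defines a linear bijection \<open>T\<close>, and choosing the factors \<open>\<delta>\<^sub>k / \<parallel>x\<^sub>k\<parallel>\<close> makes
  the pullback \<open>\<parallel>T x\<parallel>\<close> of the Euclidean norm take the value \<open>\<delta>\<^sub>k\<close> at \<open>x\<^sub>k\<close>.
\<close>

text \<open>The coefficient matrix is the Gram matrix of the images under \<open>T\<close> of the
  standard basis vectors; bilinearity of the inner product does the rest.\<close>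

lemma quadratic_form_norm_linear:
  fixes T :: "real ^ 'l \<Rightarrow> real ^ 'm"
  assumes "linear T"
  shows "quadratic_form (\<lambda>v. (norm (T v))\<^sup>2)"
proof -
  have expand: "T v = (\<Sum>i\<in>UNIV. v $ i *\<^sub>R T (axis i 1))" for v
  proof -
    have "T v = T (\<Sum>i\<in>UNIV. v $ i *\<^sub>R axis i 1)"
      using basis_expansion[of v] by (simp add: scalar_mult_eq_scaleR)
    then show ?thesis
      by (simp add: linear_sum[OF assms] linear_scale[OF assms])
  qed
  have "(norm (T v))\<^sup>2 = (\<Sum>i\<in>UNIV. \<Sum>j\<in>UNIV.
      (\<chi> i j. T (axis i 1) \<bullet> T (axis j 1)) $ i $ j * v $ i * v $ j)" for v
    unfolding power2_norm_eq_inner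
    by (subst (1 2) expand) (simp add: inner_sum_left inner_sum_right sum_distrib_left inner_commute algebra_simps)
  then show ?thesis
    unfolding quadratic_form_def by blast
qed

lemma is_norm_norm_linear:
  assumes "linear T" "inj T"
  shows "is_norm (\<lambda>v. norm (T v))"
  unfolding is_norm_def
  using assms
  by (simp add: linear_scale linear_add norm_triangle_ineq linear_injective_0 linear_0)
     (metis linear_0)

text \<open>Injectivity comes from surjectivity: in finite dimension, a linear endomorphism whose
  range contains a basis is bijective.\<close>

lemma exists_injective_rescaling:
  fixes D :: "'a :: euclidean_space set" and c :: "'a \<Rightarrow> real"
  assumes "independent D" and c: "\<And>b. b \<in> D \<Longrightarrow> c b \<noteq> 0"
  obtains T where "linear T" "inj T" "\<And>b. b \<in> D \<Longrightarrow> T b = c b *\<^sub>R b"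
proof -
  obtain B where B: "D \<subseteq> B" "independent B" "UNIV \<subseteq> span B"
    using maximal_independent_subset_extend[of D UNIV] assms(1) by auto
  \<comment> \<open>The default 1 keeps the factor nonzero on the added basis vectors, so each
    \<open>b\<close> in \<open>B\<close> has the preimage
    \<open>(1 / s b) *\<^sub>R b\<close>.\<close>
  define s where "s b = (if b \<in> D then c b else 1)" for b
  obtain T where T: "linear T" "\<And>b. b \<in> B \<Longrightarrow> T b = s b *\<^sub>R b"
    using linear_independent_extend[OF B(2), of "\<lambda>b. s b *\<^sub>R b"] by auto
  have "B \<subseteq> range T"
  proof
    fix b assume "b \<in> B"
    moreover have "s b \<noteq> 0"
      by (simp add: s_def c)
    ultimately have "b = T ((1 / s b) *\<^sub>R b)"
      by (simp add: linear_scale[OF T(1)] T(2))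
    then show "b \<in> range T"
      by blast
  qed
  then have "span B \<subseteq> range T"
    by (rule span_minimal) (simp add: linear_subspace_image T(1))
  then have "inj T"
    using B(3) by (intro linear_surjective_imp_injective T(1)) auto
  then show thesis
    using T B(1) by (intro that[of T]) (auto simp: s_def)
qed

theorem theorem1:
  fixes x :: "nat \<Rightarrow> real ^ 'l" and D :: "(real ^ 'l) set"
    and \<delta> :: "nat \<Rightarrow> real" and n :: nat
  assumes "CARD('l) > 1"
    and "D = x ` {1..n}" and "inj_on x {1..n}"
    and "independent D"
    and "\<And>k. k \<in> {1..n} \<Longrightarrow> \<delta> k > 0"
  shows "\<exists>N. is_norm N \<and>
    (\<exists>q :: real ^ 'l \<Rightarrow> real. quadratic_form q \<and> positive_definite q \<and> N = induced_norm q) \<and>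
    (\<forall>k\<in>{1..n}. N (x k) = \<delta> k)"
proof -
  \<comment> \<open>The rescaling is indexed by vectors, whereas \<delta> is indexed by numbers;
    injectivity of \<open>x\<close> on \<open>{1..n}\<close> lets the index be recovered from the
    vector.\<close>
  define c where "c b = \<delta> (the_inv_into {1..n} x b) / norm b" for b
  \<comment> \<open>An independent set omits 0, so the division by \<open>norm b\<close> is genuine
    on \<open>D\<close>.\<close>
  have nonzero: "x k \<noteq> 0" if "k \<in> {1..n}" for k
    using that assms(2,4) dependent_zero by (metis imageI)
  have c: "c (x k) = \<delta> k / norm (x k)" if "k \<in> {1..n}" for k
    unfolding c_def the_inv_into_f_f[OF assms(3) that] ..
  have c_nonzero: "c b \<noteq> 0" if "b \<in> D" for b
    using that assms(2,5) c nonzero by fastforce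
  obtain T where T: "linear T" "inj T" "\<And>b. b \<in> D \<Longrightarrow> T b = c b *\<^sub>R b"
    using exists_injective_rescaling[OF assms(4), of c] c_nonzero by blast
  define q where "q v = (norm (T v))\<^sup>2" for v
  have "quadratic_form q"
    unfolding q_def using quadratic_form_norm_linear[OF T(1)] .
  moreover have "positive_definite q"
    using T(1,2) by (auto simp: positive_definite_def q_def linear_injective_0)
  moreover have N: "induced_norm q = (\<lambda>v. norm (T v))"
    by (simp add: fun_eq_iff induced_norm_def q_def)
  moreover have "is_norm (induced_norm q)"
    unfolding N using is_norm_norm_linear[OF T(1,2)] .
  moreover have "induced_norm q (x k) = \<delta> k" if "k \<in> {1..n}" for k
  proof -
    have "T (x k) = (\<delta> k / norm (x k)) *\<^sub>R x k"
      using T(3)[of "x k"] assms(2) c that by auto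
    \<comment> \<open>The factor \<open>norm (x k)\<close> cancels, and positivity of
      \<open>\<delta> k\<close> removes the absolute value.\<close>
    then show ?thesis
      using nonzero[OF that] assms(5)[OF that] by (simp add: N)
  qed
  ultimately show ?thesis
    by blast
qed

end
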